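(* Let $X$ be a complete noncompact length space with a universal cover. Then $$CovSpec(X)\subset Cl_{lower}\big(\{h/2:\ h\in Shift(X)\}\big).$$
   Context: A complete length space is a complete metric space in which every pair of points is joined by a length-minimizing rectifiable curve whose length is the distance between the points. A universal cover $\tilde X$ of $X$ is a covering space of $X$ that covers every other covering space of $X$ (it is not assumed simply connected); covering spaces carry the lifted length metric. Each $g\in\pi_1(X)$ is viewed as a deck transformation of $\tilde X$, and its length is $L(g)=\inf_{\tilde x\in\tilde X}d_{\tilde X}(g\tilde x,\tilde x)$. The shift spectrum is $Shift(X)=\{L(g): g\in\pi_1(X)\}$. For $\delta>0$, $\pi_1(X,\delta)$ is the subgroup of $\pi_1(X)$ generated by all $g$ with $L(g)<2\delta$, and the $\delta$ cover is $\tilde X^\delta=\tilde X/\pi_1(X,\delta)$. The covering spectrum $CovSpec(X)$ is the set of all $\delta>0$ such that $\tilde X^\delta\neq\tilde X^{\delta'}$ for all $\delta'>\delta$; equivalently, $\pi_1(X,\delta)\neq\pi_1(X,\delta')$ for all $\delta'>\delta$. For $A\subset\mathbb R$, the lower semiclosure $Cl_{lower}(A)$ is the set of all limits of nonincreasing sequences of points of $A$. *)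

theory Defs
  imports "HOL-Analysis.Analysis" "HOL-Algebra.Generated_Groups"
begin

section \<open>Lengths of curves and complete length spaces\<close>

definition curve_length :: "(real \<Rightarrow> 'a::metric_space) \<Rightarrow> ennreal" where
  "curve_length \<gamma> =
     (SUP (n, t) \<in> {(n :: nat, t :: nat \<Rightarrow> real). t 0 = 0 \<and> t n = 1 \<and> mono_on {..n} t}.
        ennreal (\<Sum>i<n. dist (\<gamma> (t i)) (\<gamma> (t (Suc i)))))"

definition complete_length_space :: "'a::metric_space itself \<Rightarrow> bool" where
  "complete_length_space _ \<longleftrightarrow>
     complete (UNIV :: 'a set) \<and>
     (\<forall>x y :: 'a. \<exists>\<gamma>. path \<gamma> \<and> pathstart \<gamma> = x \<and> pathfinish \<gamma> = y \<and>
        curve_length \<gamma> = ennreal (dist x y))"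


section \<open>Covering spaces and universal covers\<close>

text \<open>
  The library constant \<^const>\<open>covering_space\<close> only speaks about total spaces that are
  subsets of a type of class \<^class>\<open>topological_space\<close>.  The universal property below quantifies over
  all covering spaces and the \<open>\<delta>\<close> covers are quotient spaces, so the same notion is needed for
  abstract topologies; \<open>covering_map_euclidean\<close> below relates the two.
\<close>

definition covering_map :: "'y topology \<Rightarrow> ('y \<Rightarrow> 'z) \<Rightarrow> 'z topology \<Rightarrow> bool" where
  "covering_map Y q Z \<longleftrightarrow>
     continuous_map Y Z q \<and> q ` topspace Y = topspace Z \<and>
     (\<forall>z \<in> topspace Z. \<exists>T. z \<in> T \<and> openin Z T \<and>
        (\<exists>V. \<Union>V = {y \<in> topspace Y. q y \<in> T} \<and>
             (\<forall>U \<in> V. openin Y U) \<and>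
             pairwise disjnt V \<and>
             (\<forall>U \<in> V. homeomorphic_map (subtopology Y U) (subtopology Z T) q)))"

lemma covering_map_euclidean:
  fixes p :: "'b::topological_space \<Rightarrow> 'a::topological_space"
  shows "covering_map euclidean p euclidean \<longleftrightarrow> covering_space UNIV p UNIV"
proof -
  have hom: "homeomorphic_map (top_of_set U) (top_of_set T) p \<longleftrightarrow> (\<exists>q. homeomorphism U T p q)"
    for U :: "'b set" and T :: "'a set"
  proof
    assume "homeomorphic_map (top_of_set U) (top_of_set T) p"
    then obtain q where "continuous_on U p" "p ` U \<subseteq> T" "continuous_on T q" "q ` T \<subseteq> U"
      "\<forall>x\<in>U. q (p x) = x" "\<forall>y\<in>T. p (q y) = y"
      by (auto simp: homeomorphic_map_maps homeomorphic_maps_def image_subset_iff_funcset)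
    then have "homeomorphism U T p q"
      by (intro homeomorphismI) auto
    then show "\<exists>q. homeomorphism U T p q" by blast
  next
    assume "\<exists>q. homeomorphism U T p q"
    then show "homeomorphic_map (top_of_set U) (top_of_set T) p"
      by (auto simp: homeomorphic_map_maps homeomorphic_maps_def homeomorphism_def)
  qed
  show ?thesis
    unfolding covering_map_def covering_space_def hom
    by (simp add: vimage_def)
qed

text \<open>
  Covering spaces are taken to be connected, as is necessary for one of them to cover all others and
  for the lifted length metric to be finite.  HOL does not allow quantification over types
  inside a formula, so the total spaces \<open>Y\<close> range over the topologies on subsets of the
  fixed type \<^typ>\<open>(real \<Rightarrow> 'a) set\<close>.  Up to isomorphism this is every connected covering
  \<open>q : Y \<rightarrow> X\<close> of a (locally path connected) length space \<open>X\<close>: by unique path lifting,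
  \<open>y \<mapsto> {q \<circ> \<gamma> | \<gamma> a path in Y from y0 to y}\<close> is injective.
\<close>

definition universal_cover :: "('b::topological_space \<Rightarrow> 'a::topological_space) \<Rightarrow> bool" where
  "universal_cover p \<longleftrightarrow>
     connected (UNIV :: 'b set) \<and>
     covering_map euclidean p euclidean \<and>
     (\<forall>(Y :: (real \<Rightarrow> 'a) set topology) q.
        connected_space Y \<and> covering_map Y q euclidean \<longrightarrow>
        (\<exists>f. covering_map euclidean f Y \<and> (\<forall>x. q (f x) = p x)))"

definition covers_isomorphic ::
    "'y topology \<times> ('y \<Rightarrow> 'x) \<Rightarrow> 'z topology \<times> ('z \<Rightarrow> 'x) \<Rightarrow> bool" where
  "covers_isomorphic C D \<longleftrightarrow>
     (\<exists>h. homeomorphic_map (fst C) (fst D) h \<and> (\<forall>y \<in> topspace (fst C). snd D (h y) = snd C y))"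

text \<open>The lifted length metric: a curve upstairs has the length of its projection.\<close>

definition lifted_dist ::
    "('b::topological_space \<Rightarrow> 'a::metric_space) \<Rightarrow> 'b \<Rightarrow> 'b \<Rightarrow> real" where
  "lifted_dist p x y =
     enn2real (INF \<gamma> \<in> {\<gamma>. path \<gamma> \<and> pathstart \<gamma> = x \<and> pathfinish \<gamma> = y}. curve_length (p \<circ> \<gamma>))"


section \<open>The fundamental group\<close>

definition loop_class :: "(real \<Rightarrow> 'a::topological_space) \<Rightarrow> (real \<Rightarrow> 'a) set" where
  "loop_class \<gamma> = {\<gamma>'. homotopic_paths UNIV \<gamma> \<gamma>'}"

lemma loop_class_eqI: "homotopic_paths UNIV \<gamma> \<gamma>' \<Longrightarrow> loop_class \<gamma> = loop_class \<gamma>'"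
  unfolding loop_class_def by (auto intro: homotopic_paths_trans homotopic_paths_sym)

definition loops_at :: "'a::topological_space \<Rightarrow> (real \<Rightarrow> 'a) set" where
  "loops_at x0 = {\<gamma>. path \<gamma> \<and> pathstart \<gamma> = x0 \<and> pathfinish \<gamma> = x0}"

definition fundamental_group :: "'a::topological_space \<Rightarrow> (real \<Rightarrow> 'a) set monoid" where
  "fundamental_group x0 =
     \<lparr>carrier = loop_class ` loops_at x0,
      mult = (\<lambda>g h. \<Union>\<gamma>\<in>g. \<Union>\<eta>\<in>h. loop_class (\<gamma> +++ \<eta>)),
      one = loop_class (\<lambda>_. x0)\<rparr>"


lemma mult_loop_class:
  assumes "\<gamma> \<in> loops_at x0" "\<eta> \<in> loops_at x0"
  shows "loop_class \<gamma> \<otimes>\<^bsub>fundamental_group x0\<^esub> loop_class \<eta> = loop_class (\<gamma> +++ \<eta>)"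
proof -
  have eq: "loop_class (\<gamma>' +++ \<eta>') = loop_class (\<gamma> +++ \<eta>)"
    if "\<gamma>' \<in> loop_class \<gamma>" "\<eta>' \<in> loop_class \<eta>" for \<gamma>' \<eta>'
  proof (rule loop_class_eqI)
    show "homotopic_paths UNIV (\<gamma>' +++ \<eta>') (\<gamma> +++ \<eta>)"
    proof (rule homotopic_paths_join)
      show h: "homotopic_paths UNIV \<gamma>' \<gamma>" "homotopic_paths UNIV \<eta>' \<eta>"
        using that by (auto simp: loop_class_def intro: homotopic_paths_sym)
      show "pathfinish \<gamma>' = pathstart \<eta>'"
        using assms homotopic_paths_imp_pathfinish [OF h(1)] homotopic_paths_imp_pathstart [OF h(2)]
        by (simp add: loops_at_def)
    qed
  qed
  have "\<gamma> \<in> loop_class \<gamma>" "\<eta> \<in> loop_class \<eta>"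
    using assms by (auto simp: loop_class_def loops_at_def)
  then have "(\<Union>\<gamma>'\<in>loop_class \<gamma>. \<Union>\<eta>'\<in>loop_class \<eta>. loop_class (\<gamma>' +++ \<eta>')) = loop_class (\<gamma> +++ \<eta>)"
    using eq by blast
  then show ?thesis
    by (simp add: fundamental_group_def)
qed

lemma group_fundamental_group: "group (fundamental_group x0)"
proof -
  let ?G = "fundamental_group x0"
  let ?c = "\<lambda>_::real. x0"
  have carr: "carrier ?G = loop_class ` loops_at x0" and one: "\<one>\<^bsub>?G\<^esub> = loop_class ?c"
    by (simp_all add: fundamental_group_def)
  have c: "?c \<in> loops_at x0"
    by (simp add: loops_at_def path_def pathstart_def pathfinish_def)
  have join: "\<gamma> +++ \<eta> \<in> loops_at x0" if "\<gamma> \<in> loops_at x0" "\<eta> \<in> loops_at x0" for \<gamma> \<eta>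
    using that by (simp add: loops_at_def)
  have rev: "reversepath \<gamma> \<in> loops_at x0" if "\<gamma> \<in> loops_at x0" for \<gamma>
    using that by (simp add: loops_at_def)
  have id: "\<gamma> \<circ> linepath 0 1 = \<gamma>" for \<gamma> :: "real \<Rightarrow> 'a"
    by (auto simp: linepath_def)
  have lid: "homotopic_paths UNIV (?c +++ \<gamma>) \<gamma>" if g: "\<gamma> \<in> loops_at x0" for \<gamma>
  proof -
    have "homotopic_paths {0..1::real} (linepath 0 0 +++ linepath 0 1) (linepath 0 1)"
      by (rule homotopic_paths_lid') (auto simp: closed_segment_eq_real_ivl)
    then have "homotopic_paths UNIV (\<gamma> \<circ> (linepath 0 0 +++ linepath 0 1)) (\<gamma> \<circ> linepath 0 1)"
      by (rule homotopic_paths_continuous_image) (use g in \<open>auto simp: loops_at_def path_def\<close>)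
    moreover have "\<gamma> \<circ> linepath 0 0 = ?c"
      using g by (auto simp: loops_at_def linepath_def pathstart_def)
    ultimately show ?thesis
      by (simp add: path_compose_join id)
  qed
  have linv: "homotopic_paths UNIV (reversepath \<gamma> +++ \<gamma>) ?c" if g: "\<gamma> \<in> loops_at x0" for \<gamma>
  proof -
    have "homotopic_paths {0..1::real} (reversepath (linepath 0 1) +++ linepath 0 1)
        (linepath (pathfinish (linepath 0 1)) (pathfinish (linepath 0 1)))"
      by (rule homotopic_paths_linv) (auto simp: closed_segment_eq_real_ivl)
    then have "homotopic_paths UNIV (\<gamma> \<circ> (reversepath (linepath 0 1) +++ linepath 0 1))
        (\<gamma> \<circ> linepath (pathfinish (linepath 0 1)) (pathfinish (linepath 0 1)))"
      by (rule homotopic_paths_continuous_image) (use g in \<open>auto simp: loops_at_def path_def\<close>)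
    moreover have "\<gamma> \<circ> linepath (pathfinish (linepath 0 1)) (pathfinish (linepath 0 1)) = ?c"
      using g by (auto simp: loops_at_def linepath_def pathfinish_def)
    ultimately show ?thesis
      by (simp add: path_compose_join path_compose_reversepath id del: reversepath_linepath)
  qed
  show ?thesis
  proof (rule groupI)
    show "\<one>\<^bsub>?G\<^esub> \<in> carrier ?G"
      using c by (simp add: carr one)
  next
    fix g h assume "g \<in> carrier ?G" "h \<in> carrier ?G"
    then show "g \<otimes>\<^bsub>?G\<^esub> h \<in> carrier ?G"
      using join by (auto simp: carr mult_loop_class)
  next
    fix g h k assume "g \<in> carrier ?G" "h \<in> carrier ?G" "k \<in> carrier ?G"
    then obtain \<gamma> \<eta> \<kappa> where
      "g = loop_class \<gamma>" "\<gamma> \<in> loops_at x0" "h = loop_class \<eta>" "\<eta> \<in> loops_at x0"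
      "k = loop_class \<kappa>" "\<kappa> \<in> loops_at x0"
      by (auto simp: carr)
    moreover from this have "loop_class ((\<gamma> +++ \<eta>) +++ \<kappa>) = loop_class (\<gamma> +++ (\<eta> +++ \<kappa>))"
      by (intro loop_class_eqI homotopic_paths_sym [OF homotopic_paths_assoc])
        (auto simp: loops_at_def)
    ultimately show "g \<otimes>\<^bsub>?G\<^esub> h \<otimes>\<^bsub>?G\<^esub> k = g \<otimes>\<^bsub>?G\<^esub> (h \<otimes>\<^bsub>?G\<^esub> k)"
      by (simp add: mult_loop_class join)
  next
    fix g assume "g \<in> carrier ?G"
    then obtain \<gamma> where "g = loop_class \<gamma>" "\<gamma> \<in> loops_at x0"
      by (auto simp: carr)
    then show "\<one>\<^bsub>?G\<^esub> \<otimes>\<^bsub>?G\<^esub> g = g"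
      using loop_class_eqI [OF lid] c by (simp add: one mult_loop_class)
  next
    fix g assume "g \<in> carrier ?G"
    then obtain \<gamma> where "g = loop_class \<gamma>" "\<gamma> \<in> loops_at x0"
      by (auto simp: carr)
    then show "\<exists>h \<in> carrier ?G. h \<otimes>\<^bsub>?G\<^esub> g = \<one>\<^bsub>?G\<^esub>"
      using loop_class_eqI [OF linv] rev
      by (intro bexI[of _ "loop_class (reversepath \<gamma>)"]) (simp_all add: carr one mult_loop_class)
  qed
qed


section \<open>Deck transformations\<close>

definition deck_transformations :: "('b::topological_space \<Rightarrow> 'a) \<Rightarrow> ('b \<Rightarrow> 'b) set" where
  "deck_transformations p = {\<phi>. (\<exists>\<psi>. homeomorphism UNIV UNIV \<phi> \<psi>) \<and> p \<circ> \<phi> = p}"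

text \<open>
  A base point \<open>xt\<close> of the universal cover is fixed.  The class \<open>g\<close> of loops at \<open>p xt\<close> acts as the
  deck transformation that sends \<open>xt\<close> to the endpoint of the lift at \<open>xt\<close> of a loop in \<open>g\<close>;
  it exists and is unique because a universal cover is regular.  As the universal cover need not
  be simply connected, this action need not be faithful.
\<close>

definition deck_action ::
    "('b::topological_space \<Rightarrow> 'a::topological_space) \<Rightarrow> 'b \<Rightarrow> (real \<Rightarrow> 'a) set \<Rightarrow> 'b \<Rightarrow> 'b" where
  "deck_action p xt g =
     (THE \<phi>. \<phi> \<in> deck_transformations p \<and>
        (\<exists>\<gamma>. path \<gamma> \<and> pathstart \<gamma> = xt \<and> pathfinish \<gamma> = \<phi> xt \<and> p \<circ> \<gamma> \<in> g))"

definition deck_length ::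
    "('b::topological_space \<Rightarrow> 'a::metric_space) \<Rightarrow> 'b \<Rightarrow> (real \<Rightarrow> 'a) set \<Rightarrow> real" where
  "deck_length p xt g = (INF x. lifted_dist p (deck_action p xt g x) x)"

definition Shift :: "('b::topological_space \<Rightarrow> 'a::metric_space) \<Rightarrow> 'b \<Rightarrow> real set" where
  "Shift p xt = deck_length p xt ` carrier (fundamental_group (p xt))"


section \<open>The delta covers and the covering spectrum\<close>

definition pi1_delta ::
    "('b::topological_space \<Rightarrow> 'a::metric_space) \<Rightarrow> 'b \<Rightarrow> real \<Rightarrow> (real \<Rightarrow> 'a) set set" where
  "pi1_delta p xt \<delta> =
     generate (fundamental_group (p xt))
       {g \<in> carrier (fundamental_group (p xt)). deck_length p xt g < 2 * \<delta>}"

definition orbit_of ::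
    "('b::topological_space \<Rightarrow> 'a::topological_space) \<Rightarrow> 'b \<Rightarrow> (real \<Rightarrow> 'a) set set \<Rightarrow> 'b \<Rightarrow> 'b set" where
  "orbit_of p xt H x = (\<lambda>g. deck_action p xt g x) ` H"

definition orbit_space ::
    "('b::topological_space \<Rightarrow> 'a::topological_space) \<Rightarrow> 'b \<Rightarrow> (real \<Rightarrow> 'a) set set \<Rightarrow> 'b set topology" where
  "orbit_space p xt H =
     topology (\<lambda>W. W \<subseteq> range (orbit_of p xt H) \<and> open (orbit_of p xt H -` W))"

lemma quotient_map_orbit_of: "quotient_map euclidean (orbit_space p xt H) (orbit_of p xt H)"
proof -
  let ?o = "orbit_of p xt H"
  have "istopology (\<lambda>W. W \<subseteq> range ?o \<and> open (?o -` W))"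
    unfolding istopology_def
  proof (intro conjI allI impI)
    fix \<K> assume "\<forall>K\<in>\<K>. K \<subseteq> range ?o \<and> open (?o -` K)"
    then show "\<Union>\<K> \<subseteq> range ?o" "open (?o -` \<Union>\<K>)"
      by (simp_all add: Sup_le_iff vimage_Union open_UN)
  qed (simp_all add: le_infI1 open_Int)
  then have op: "openin (orbit_space p xt H) W \<longleftrightarrow> W \<subseteq> range ?o \<and> open (?o -` W)" for W
    by (simp add: orbit_space_def)
  have "?o -` range ?o = UNIV"
    by blast
  then have "topspace (orbit_space p xt H) = range ?o"
    using op[of "range ?o"] op[of "topspace (orbit_space p xt H)"]
    by (metis open_UNIV openin_subset openin_topspace subset_antisym subset_refl)
  then show ?thesis
    by (simp add: quotient_map_def op vimage_def)
qed

definition orbit_proj :: "('b \<Rightarrow> 'a) \<Rightarrow> 'b set \<Rightarrow> 'a" where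
  "orbit_proj p S = the_elem (p ` S)"

definition delta_cover ::
    "('b::topological_space \<Rightarrow> 'a::metric_space) \<Rightarrow> 'b \<Rightarrow> real \<Rightarrow> 'b set topology \<times> ('b set \<Rightarrow> 'a)" where
  "delta_cover p xt \<delta> = (orbit_space p xt (pi1_delta p xt \<delta>), orbit_proj p)"

text \<open>Two \<open>\<delta>\<close> covers count as equal when they are isomorphic as covering spaces.\<close>

definition CovSpec :: "('b::topological_space \<Rightarrow> 'a::metric_space) \<Rightarrow> 'b \<Rightarrow> real set" where
  "CovSpec p xt =
     {\<delta>. \<delta> > 0 \<and> (\<forall>\<delta>'>\<delta>. \<not> covers_isomorphic (delta_cover p xt \<delta>) (delta_cover p xt \<delta>'))}"

definition Cl_lower :: "real set \<Rightarrow> real set" where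
  "Cl_lower A = {x. \<exists>a :: nat \<Rightarrow> real. (\<forall>n. a n \<in> A) \<and> decseq a \<and> a \<longlonglongrightarrow> x}"

end

theory Submission
  imports Defs
begin

text \<open>
  Equal subgroups \<open>\<pi>\<^sub>1(X,\<delta>)\<close> give literally the same \<open>\<delta>\<close> cover, so at a point \<open>\<delta>\<close> of the
  covering spectrum the subgroup strictly grows when \<open>\<delta>\<close> is replaced by any larger \<open>\<delta>'\<close>.
  A subgroup is determined by its generators; hence some \<open>g\<close> is among the generators of
  the larger group but not among those of the smaller one, which says exactly that \<open>\<delta> \<le> L(g) / 2 < \<delta>'\<close>.
  Thus half-shifts accumulate at \<open>\<delta>\<close> from above, in the weak sense that \<open>\<delta>\<close> may itself be one
  (\<open>pi1_delta_gap\<close>), and such points lie in the lower semiclosure (\<open>Cl_lowerI\<close>).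
\<close>

text \<open>
  Either the point itself belongs to the set, and a constant sequence does, or all the
  approximations are strict and each can be chosen below the previous one.
\<close>

lemma Cl_lowerI:
  assumes approx: "\<And>y. x < y \<Longrightarrow> \<exists>a\<in>A. x \<le> a \<and> a < y"
  shows "x \<in> Cl_lower A"
proof (cases "x \<in> A")
  case True
  then show ?thesis
    unfolding Cl_lower_def by (intro CollectI exI[of _ "\<lambda>_. x"]) (simp add: decseq_def)
next
  case False
  have strict: "\<exists>a\<in>A. x < a \<and> a < y" if "x < y" for y
    using approx [OF that] False by (metis order_le_less)
  have "\<exists>a. \<forall>n. (a n \<in> A \<and> x < a n \<and> a n < x + inverse (real (Suc n))) \<and> a (Suc n) \<le> a n"
  proof (rule dependent_nat_choice)
    show "\<exists>a. a \<in> A \<and> x < a \<and> a < x + inverse (real (Suc 0))"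
      using strict [of "x + 1"] by auto
  next
    fix a n
    assume "a \<in> A \<and> x < a \<and> a < x + inverse (real (Suc n))"
    then have "x < min a (x + inverse (real (Suc (Suc n))))"
      by simp
    from strict [OF this]
    show "\<exists>b. (b \<in> A \<and> x < b \<and> b < x + inverse (real (Suc (Suc n)))) \<and> b \<le> a"
      by auto
  qed
  then obtain a where a: "\<And>n. a n \<in> A" "\<And>n. x < a n"
      "\<And>n. a n < x + inverse (real (Suc n))" "\<And>n. a (Suc n) \<le> a n"
    by blast
  have "a \<longlonglongrightarrow> x"
    by (rule tendsto_sandwich [OF _ _ tendsto_const LIMSEQ_inverse_real_of_nat_add])
      (use a in \<open>auto intro!: always_eventually less_imp_le simp del: of_nat_Suc\<close>)
  with a show ?thesis
    unfolding Cl_lower_def by (blast intro: decseq_SucI)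
qed

lemma pi1_delta_gap:
  assumes "pi1_delta p xt \<delta> \<noteq> pi1_delta p xt \<delta>'" and "\<delta> < \<delta>'"
  shows "\<exists>h\<in>Shift p xt. \<delta> \<le> h / 2 \<and> h / 2 < \<delta>'"
proof -
  let ?S = "\<lambda>\<epsilon>. {g \<in> carrier (fundamental_group (p xt)). deck_length p xt g < 2 * \<epsilon>}"
  have "?S \<delta> \<noteq> ?S \<delta>'"
    using assms(1) by (auto simp: pi1_delta_def)
  moreover have "?S \<delta> \<subseteq> ?S \<delta>'"
    using assms(2) by auto
  ultimately obtain g where "g \<in> carrier (fundamental_group (p xt))"
      "deck_length p xt g < 2 * \<delta>'" "\<not> deck_length p xt g < 2 * \<delta>"
    by blast
  then show ?thesis
    by (intro bexI[of _ "deck_length p xt g"]) (auto simp: Shift_def)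
qed

lemma covers_isomorphic_refl: "covers_isomorphic C C"
  unfolding covers_isomorphic_def by (intro exI[of _ id]) simp

theorem theorem3p3:
  fixes p :: "'b::topological_space \<Rightarrow> 'a::metric_space" and xt :: 'b
  assumes "complete_length_space TYPE('a)"
    and "\<not> compact (UNIV :: 'a set)"
    and "universal_cover p"
  shows "CovSpec p xt \<subseteq> Cl_lower {h / 2 | h. h \<in> Shift p xt}"
proof
  fix \<delta> assume \<delta>: "\<delta> \<in> CovSpec p xt"
  show "\<delta> \<in> Cl_lower {h / 2 | h. h \<in> Shift p xt}"
  proof (rule Cl_lowerI)
    fix \<delta>' assume "\<delta> < \<delta>'"
    moreover from this \<delta> have "pi1_delta p xt \<delta> \<noteq> pi1_delta p xt \<delta>'"
      by (metis (mono_tags, lifting) CovSpec_def covers_isomorphic_refl delta_cover_def mem_Collect_eq)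
    ultimately show "\<exists>a\<in>{h / 2 | h. h \<in> Shift p xt}. \<delta> \<le> a \<and> a < \<delta>'"
      using pi1_delta_gap by blast
  qed
qed

end
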